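(* Let $q\geq 2$ be an integer with $q\neq 3$, and suppose that there exists a doubly regular tournament of order $q$. Then there exists an $\mathrm{OMZD}(q)$.
   Context: An $n\times n$ real matrix $A$ is called orthogonal if $AA^{\mathrm{T}}=cI$ for some real constant $c>0$ (it is not required that $c=1$). An $\mathrm{OMZD}(n)$ (orthogonal matrix with zero diagonal) is an $n\times n$ real matrix that is orthogonal in this sense, whose diagonal entries are all zero and whose off-diagonal entries are all nonzero. A doubly regular tournament of order $q$ is an orientation of the complete graph on $q$ vertices for which there are integers $k$ and $\lambda$ such that each vertex has out-degree $k$ and, for any pair of distinct vertices $u,w$, there are exactly $\lambda$ vertices $x$ such that both $u\to x$ and $w\to x$ are arcs. *)

theory Defs
  imports Complex_Main "Graph_Theory.Digraph" "Jordan_Normal_Form.Matrix"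
begin

text \<open>
  The locale \<^locale>\<open>digraph\<close> means finite, without loops and without parallel arcs, so together
  with the axiom below a tournament is exactly an orientation of a complete graph.
\<close>

locale tournament = digraph +
  assumes orientation:
    "\<lbrakk>u \<in> verts G; v \<in> verts G; u \<noteq> v\<rbrakk> \<Longrightarrow> (u \<rightarrow> v) \<longleftrightarrow> \<not> (v \<rightarrow> u)"

definition doubly_regular_tournament :: "nat \<Rightarrow> ('a, 'b) pre_digraph \<Rightarrow> bool" where
  "doubly_regular_tournament q G \<longleftrightarrow>
     tournament G \<and> card (verts G) = q \<and>
     (\<exists>k l :: nat.
        (\<forall>u \<in> verts G. out_degree G u = k) \<and>
        (\<forall>u \<in> verts G. \<forall>w \<in> verts G. u \<noteq> w \<longrightarrow>
           card {x \<in> verts G. (u \<rightarrow>\<^bsub>G\<^esub> x) \<and> (w \<rightarrow>\<^bsub>G\<^esub> x)} = l))"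

text \<open>
  This is not the library's \<^const>\<open>orthogonal_mat\<close>, which only asks for pairwise orthogonal
  nonzero columns; here the product with the transpose has to be a positive scalar matrix.
\<close>

definition scaled_orthogonal :: "nat \<Rightarrow> real mat \<Rightarrow> bool" where
  "scaled_orthogonal n A \<longleftrightarrow>
     A \<in> carrier_mat n n \<and> (\<exists>c > 0. A * transpose_mat A = c \<cdot>\<^sub>m 1\<^sub>m n)"

definition OMZD :: "nat \<Rightarrow> real mat \<Rightarrow> bool" where
  "OMZD n A \<longleftrightarrow>
     scaled_orthogonal n A \<and>
     (\<forall>i < n. A $$ (i, i) = 0) \<and>
     (\<forall>i < n. \<forall>j < n. i \<noteq> j \<longrightarrow> A $$ (i, j) \<noteq> 0)"

end

theory Submission
  imports Defs
begin

text \<open>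
  Let \<open>N\<close> be the adjacency matrix of the tournament. Double counting gives \<open>q = 2 k + 1\<close> and
  \<open>k = 2 l + 1\<close>, so \<open>l > 0\<close> as \<open>q \<noteq> 3\<close>. All off-diagonal entries of the Gram matrix of the rows
  of \<open>t N + N\<^sup>T\<close> are then equal to \<open>l t\<^sup>2 + (2 l + 1) t + l\<close>, a quadratic in \<open>t\<close> with
  discriminant \<open>4 l + 1\<close> and nonzero constant term; any real root \<open>t\<close> yields the matrix.
\<close>

lemma (in nomulti_digraph) out_degree_eq_card_dominated:
  "out_degree G u = card {x \<in> verts G. u \<rightarrow> x}"
proof -
  \<comment> \<open>Out-degree counts arcs, while \<open>l\<close> counts vertices. Without parallel
    arcs, an arc leaving \<open>u\<close> is determined by its head, which reconciles the two
    counts.\<close>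
  have "inj_on (head G) (out_arcs G u)"
    by (auto intro!: inj_onI no_multi_arcs simp: arc_to_ends_def)
  moreover have "head G ` out_arcs G u = {x \<in> verts G. u \<rightarrow> x}"
    by (auto simp: arcs_ends_def arc_to_ends_def)
  ultimately show ?thesis
    by (metis card_image out_degree_def)
qed

definition adjacency :: "('a, 'b) pre_digraph \<Rightarrow> 'a \<Rightarrow> 'a \<Rightarrow> real" where
  "adjacency G u v = of_bool (u \<rightarrow>\<^bsub>G\<^esub> v)"

lemma (in digraph) sum_adjacency_row:
  "(\<Sum>x\<in>verts G. adjacency G u x) = out_degree G u"
  by (simp add: adjacency_def out_degree_eq_card_dominated Int_def)

text \<open>In matrix form this is \<open>N\<^sup>T = J - I - N\<close>, with \<open>J\<close> the
  all-ones matrix. It trades incoming arcs for outgoing ones, the only ones that the regularity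
  conditions control.\<close>

lemma (in tournament) adjacency_converse:
  assumes "u \<in> verts G" "v \<in> verts G"
  shows "adjacency G v u = 1 - of_bool (u = v) - adjacency G u v"
  using orientation[OF assms] adj_not_same by (cases "u = v") (auto simp: adjacency_def)

lemma (in tournament) sum_adjacency_column:
  assumes "u \<in> verts G"
  shows "(\<Sum>x\<in>verts G. adjacency G x u) = real (card (verts G)) - 1 - out_degree G u"
proof -
  have "(\<Sum>x\<in>verts G. adjacency G x u)
      = (\<Sum>x\<in>verts G. 1 - of_bool (u = x) - adjacency G u x)"
    using assms by (intro sum.cong refl adjacency_converse)
  also have "\<dots> = real (card (verts G)) - (\<Sum>x\<in>verts G. of_bool (u = x)) - out_degree G u"
    by (simp only: sum_subtractf sum_adjacency_row) simp
  also have "(\<Sum>x\<in>verts G. of_bool (u = x) :: real) = 1"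
    using assms by (simp add: of_bool_def)
  finally show ?thesis .
qed

text \<open>Counting arcs by tails and by heads gives \<open>q * k = q * (q - 1 - k)\<close>; a
  nonempty vertex set allows cancelling \<open>q\<close>.\<close>

lemma (in tournament) regular_tournament_order:
  assumes "\<And>u. u \<in> verts G \<Longrightarrow> out_degree G u = k" "verts G \<noteq> {}"
  shows "card (verts G) = 2 * k + 1"
proof -
  let ?q = "real (card (verts G))"
  have "?q * real k = (\<Sum>u\<in>verts G. \<Sum>x\<in>verts G. adjacency G u x)"
    by (simp only: sum_adjacency_row) (simp add: assms)
  also have "\<dots> = (\<Sum>x\<in>verts G. \<Sum>u\<in>verts G. adjacency G u x)"
    by (rule sum.swap)
  also have "\<dots> = ?q * (?q - 1 - k)"
    by (simp only: sum_adjacency_column cong: sum.cong) (simp add: assms)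
  finally have "real k = ?q - 1 - k"
    using assms(2) by simp
  then have "real (card (verts G)) = real (2 * k + 1)"
    by simp
  then show ?thesis
    by (simp only: of_nat_eq_iff)
qed

lemma (in digraph) sum_adjacency_mult:
  "(\<Sum>x\<in>verts G. adjacency G u x * adjacency G w x)
    = card {x \<in> verts G. (u \<rightarrow> x) \<and> (w \<rightarrow> x)}"
  by (simp add: adjacency_def of_bool_conj[symmetric] Int_def)

text \<open>Fix \<open>u\<close> and count the pairs \<open>(x, w)\<close> with arcs from both
  \<open>u\<close> and \<open>w\<close> to \<open>x\<close>. Each of the \<open>k\<close> choices of
  \<open>x\<close> has in-degree \<open>k\<close>. On the other side, \<open>w = u\<close>
  contributes \<open>k\<close> and each of the other \<open>2 * k\<close> vertices contributes
  \<open>l\<close>. Hence \<open>k * k = k + 2 * k * l\<close>.\<close>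

lemma (in tournament) doubly_regular_tournament_degree:
  assumes reg: "\<And>u. u \<in> verts G \<Longrightarrow> out_degree G u = k"
    and dbl: "\<And>u w. u \<in> verts G \<Longrightarrow> w \<in> verts G \<Longrightarrow> u \<noteq> w \<Longrightarrow>
      card {x \<in> verts G. (u \<rightarrow> x) \<and> (w \<rightarrow> x)} = l"
    and "card (verts G) \<ge> 2"
  shows "k = 2 * l + 1"
proof -
  have "verts G \<noteq> {}"
    using assms(3) by auto
  then obtain u where u: "u \<in> verts G"
    by blast
  have q: "card (verts G) = 2 * k + 1"
    using regular_tournament_order reg \<open>verts G \<noteq> {}\<close> by blast
  have in_degree: "(\<Sum>w\<in>verts G. adjacency G w x) = k" if "x \<in> verts G" for x
    using that by (simp add: sum_adjacency_column reg q)
  have same: "{x \<in> verts G. (u \<rightarrow> x) \<and> (u \<rightarrow> x)} = {x \<in> verts G. u \<rightarrow> x}"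
    by simp
  have "real k * k = (\<Sum>x\<in>verts G. adjacency G u x * real k)"
    by (simp only: sum_distrib_right[symmetric] sum_adjacency_row reg[OF u])
  also have "\<dots> = (\<Sum>x\<in>verts G. \<Sum>w\<in>verts G. adjacency G u x * adjacency G w x)"
    by (simp only: sum_distrib_left[symmetric] in_degree cong: sum.cong)
  also have "\<dots> = (\<Sum>w\<in>verts G. real (card {x \<in> verts G. (u \<rightarrow> x) \<and> (w \<rightarrow> x)}))"
    by (subst sum.swap) (simp only: sum_adjacency_mult)
  also have "\<dots> = real k + (\<Sum>w\<in>verts G - {u}. real (card {x \<in> verts G. (u \<rightarrow> x) \<and> (w \<rightarrow> x)}))"
    using reg[OF u] u same by (simp only: sum.remove[OF finite_verts u] out_degree_eq_card_dominated)
  also have "(\<Sum>w\<in>verts G - {u}. real (card {x \<in> verts G. (u \<rightarrow> x) \<and> (w \<rightarrow> x)}))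
      = (\<Sum>w\<in>verts G - {u}. real l)"
    using u by (intro sum.cong refl arg_cong[of _ _ real] dbl) auto
  also have "\<dots> = 2 * real k * l"
    using u by (simp add: q)
  finally have "real k * k = real k * (2 * l + 1)"
    by (simp add: algebra_simps)
  moreover have "k \<noteq> 0"
    using assms(3) q by auto
  ultimately have "real k = real (2 * l + 1)"
    by simp
  then show ?thesis
    by (simp only: of_nat_eq_iff)
qed

lemma exists_nonzero_quadratic_root:
  fixes l :: real
  assumes "l > 0"
  obtains t where "t \<noteq> 0" "l * t\<^sup>2 + (2 * l + 1) * t + l = 0"
proof
  define t where "t = (sqrt (4 * l + 1) - (2 * l + 1)) / (2 * l)"
  have "2 * l * t + (2 * l + 1) = sqrt (4 * l + 1)"
    using assms by (simp add: t_def)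
  then have "(2 * l * t + (2 * l + 1))\<^sup>2 = 4 * l + 1"
    using assms by simp
  \<comment> \<open>Completing the square: the discriminant is
    \<open>(2 * l + 1)\<^sup>2 - 4 * l\<^sup>2 = 4 * l + 1\<close>.\<close>
  then have "4 * l * (l * t\<^sup>2 + (2 * l + 1) * t + l) = 0"
    by (simp add: power2_eq_square algebra_simps)
  then show *: "l * t\<^sup>2 + (2 * l + 1) * t + l = 0"
    using assms by simp
  show "t \<noteq> 0"
    using * assms by auto
qed

definition arc_weight :: "real \<Rightarrow> ('a, 'b) pre_digraph \<Rightarrow> 'a \<Rightarrow> 'a \<Rightarrow> real" where
  "arc_weight t G u v = t * adjacency G u v + adjacency G v u"

lemma (in digraph) arc_weight_same: "arc_weight t G u u = 0"
  using adj_not_same by (auto simp: arc_weight_def adjacency_def)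

lemma (in tournament) arc_weight_nonzero:
  assumes "u \<in> verts G" "v \<in> verts G" "u \<noteq> v" "t \<noteq> 0"
  shows "arc_weight t G u v \<noteq> 0"
  using orientation[OF assms(1-3)] assms(4) by (cases "u \<rightarrow> v") (auto simp: arc_weight_def adjacency_def)

text \<open>At most one of \<open>adjacency G u x\<close> and \<open>adjacency G x u\<close> is
  nonzero, so squaring produces no cross term, and 0/1 values equal their squares.\<close>

lemma (in tournament) sum_arc_weight_same:
  assumes "u \<in> verts G"
  shows "(\<Sum>x\<in>verts G. (arc_weight t G u x)\<^sup>2)
    = t\<^sup>2 * out_degree G u + (real (card (verts G)) - 1 - out_degree G u)"
proof -
  have "(arc_weight t G u x)\<^sup>2 = t\<^sup>2 * adjacency G u x + adjacency G x u" if "x \<in> verts G" for x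
    using orientation[OF assms that] adj_not_same
    by (cases "u = x"; cases "u \<rightarrow> x") (auto simp: arc_weight_def adjacency_def)
  then show ?thesis
    by (simp only: sum.distrib sum_distrib_left[symmetric] sum_adjacency_row
        sum_adjacency_column[OF assms] cong: sum.cong)
qed

text \<open>Since \<open>N\<^sup>T = J - I - N\<close>, the weights form the matrix
  \<open>J - I + (t - 1) N\<close>. Expanding the product of two of its rows leaves only out-degrees
  and common out-neighbours.\<close>

lemma (in tournament) sum_arc_weight_distinct:
  assumes u: "u \<in> verts G" and w: "w \<in> verts G" and "u \<noteq> w"
  shows "(\<Sum>x\<in>verts G. arc_weight t G u x * arc_weight t G w x)
    = real (card (verts G)) - 2 + (t - 1) * (real (out_degree G u) + out_degree G w - 1)
      + (t - 1)\<^sup>2 * card {x \<in> verts G. (u \<rightarrow> x) \<and> (w \<rightarrow> x)}"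
proof -
  have arc: "adjacency G u w + adjacency G w u = 1"
    using adjacency_converse[OF u w] \<open>u \<noteq> w\<close> by simp
  \<comment> \<open>The two indicators are never both 1, so their product is dropped; each cross
    term with an indicator is evaluated at the single vertex it selects.\<close>
  have "arc_weight t G u x * arc_weight t G w x
      = 1 - of_bool (u = x) - of_bool (w = x)
        + (t - 1) * (adjacency G u x + adjacency G w x
            - of_bool (u = x) * adjacency G w u - of_bool (w = x) * adjacency G u w)
        + (t - 1)\<^sup>2 * (adjacency G u x * adjacency G w x)" if "x \<in> verts G" for x
    using \<open>u \<noteq> w\<close> adj_not_same
    unfolding arc_weight_def adjacency_converse[OF u that] adjacency_converse[OF w that]
    by (cases "u = x"; cases "w = x") (auto simp: algebra_simps power2_eq_square)
  then have "(\<Sum>x\<in>verts G. arc_weight t G u x * arc_weight t G w x)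
      = (\<Sum>x\<in>verts G. 1 - of_bool (u = x) - of_bool (w = x)
        + (t - 1) * (adjacency G u x + adjacency G w x
            - of_bool (u = x) * adjacency G w u - of_bool (w = x) * adjacency G u w)
        + (t - 1)\<^sup>2 * (adjacency G u x * adjacency G w x))"
    by (rule sum.cong[OF refl])
  also have "\<dots> = (\<Sum>x\<in>verts G. 1) - (\<Sum>x\<in>verts G. of_bool (u = x)) - (\<Sum>x\<in>verts G. of_bool (w = x))
        + (t - 1) * (real (out_degree G u) + out_degree G w
            - (\<Sum>x\<in>verts G. of_bool (u = x)) * adjacency G w u
            - (\<Sum>x\<in>verts G. of_bool (w = x)) * adjacency G u w)
        + (t - 1)\<^sup>2 * card {x \<in> verts G. (u \<rightarrow> x) \<and> (w \<rightarrow> x)}"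
    by (simp only: sum.distrib sum_subtractf sum_distrib_left[symmetric]
        sum_distrib_right[symmetric] sum_adjacency_row sum_adjacency_mult)
  also have "(\<Sum>x\<in>verts G. of_bool (u = x) :: real) = 1"
    using u by (simp add: of_bool_def)
  also have "(\<Sum>x\<in>verts G. of_bool (w = x) :: real) = 1"
    using w by (simp add: of_bool_def)
  \<comment> \<open>Exactly one of the arcs between \<open>u\<close> and \<open>w\<close> is
    present; this is the \<open>- 1\<close> in the factor of \<open>t - 1\<close>.\<close>
  finally show ?thesis
    using arc by (simp add: algebra_simps)
qed

theorem theorem4p2:
  fixes q :: nat and G :: "('a, 'b) pre_digraph"
  assumes "q \<ge> 2" and "q \<noteq> 3"
    and "doubly_regular_tournament q G"
  shows "\<exists>A :: real mat. OMZD q A"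
proof -
  from assms(3) obtain k l where "tournament G" and card: "card (verts G) = q"
    and reg: "\<And>u. u \<in> verts G \<Longrightarrow> out_degree G u = k"
    and dbl: "\<And>u w. u \<in> verts G \<Longrightarrow> w \<in> verts G \<Longrightarrow> u \<noteq> w \<Longrightarrow>
      card {x \<in> verts G. (u \<rightarrow>\<^bsub>G\<^esub> x) \<and> (w \<rightarrow>\<^bsub>G\<^esub> x)} = l"
    unfolding doubly_regular_tournament_def by blast
  interpret tournament G by fact
  have "verts G \<noteq> {}"
    using assms(1) card by auto
  then have q: "q = 2 * k + 1"
    using regular_tournament_order reg card by blast
  have k: "k = 2 * l + 1"
    using doubly_regular_tournament_degree reg dbl card assms(1) by blast
  \<comment> \<open>If \<open>l = 0\<close>, then \<open>k = 1\<close> and \<open>q = 3\<close>, the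
    excluded order.\<close>
  have "l > 0"
    using assms(2) q k by (cases l) auto
  then have "real l > 0"
    by simp
  then obtain t where t: "t \<noteq> 0" "real l * t\<^sup>2 + (2 * real l + 1) * t + real l = 0"
    by (rule exists_nonzero_quadratic_root)
  obtain h where h: "bij_betw h {0..<q} (verts G)"
    using ex_bij_betw_nat_finite[OF finite_verts] card by blast
  have hV: "h i \<in> verts G" if "i < q" for i
    using h that by (auto simp: bij_betw_def)
  have h_neq: "h i \<noteq> h j" if "i < q" "j < q" "i \<noteq> j" for i j
    using h that by (auto simp: bij_betw_def inj_on_def)
  define A where "A = mat q q (\<lambda>(i, j). arc_weight t G (h i) (h j))"
  have gram_h: "(A * transpose_mat A) $$ (i, j)
      = (\<Sum>x\<in>verts G. arc_weight t G (h i) x * arc_weight t G (h j) x)"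
    if "i < q" "j < q" for i j
    using that by (simp add: A_def scalar_prod_def
        sum.reindex_bij_betw[OF h, of "\<lambda>x. arc_weight t G (h i) x * arc_weight t G (h j) x"])
  have gram: "(A * transpose_mat A) $$ (i, j) = (if i = j then (t\<^sup>2 + 1) * k else 0)"
    if ij: "i < q" "j < q" for i j
  proof (cases "i = j")
    case True
    have "(A * transpose_mat A) $$ (i, j) = (\<Sum>x\<in>verts G. (arc_weight t G (h i) x)\<^sup>2)"
      using gram_h[OF ij] True by (simp add: power2_eq_square)
    \<comment> \<open>Each vertex has in-degree \<open>q - 1 - k = k\<close> as well.\<close>
    also have "\<dots> = (t\<^sup>2 + 1) * k"
      using ij by (simp add: sum_arc_weight_same hV reg card q algebra_simps)
    finally show ?thesis
      using True by simp
  next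
    case False
    have "(A * transpose_mat A) $$ (i, j)
        = real q - 2 + (t - 1) * (real k + k - 1) + (t - 1)\<^sup>2 * l"
      unfolding gram_h[OF ij]
      by (simp only: sum_arc_weight_distinct hV ij h_neq False not_False_eq_True reg dbl card)
    \<comment> \<open>Here \<open>q - 2\<close> and \<open>2 * k - 1\<close> both equal
      \<open>4 * l + 1\<close>, so the first two summands combine to
      \<open>(4 * l + 1) * t\<close>.\<close>
    also have "\<dots> = real l * t\<^sup>2 + (2 * real l + 1) * t + real l"
      by (simp add: q k algebra_simps power2_eq_square)
    finally show ?thesis
      using t False by simp
  qed
  have "A * transpose_mat A = ((t\<^sup>2 + 1) * k) \<cdot>\<^sub>m 1\<^sub>m q"
    \<comment> \<open>Deleting the entry rule for products keeps them from unfolding into scalar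
      products before \<open>gram\<close> applies; \<open>A_def\<close> then settles the
      dimensions.\<close>
    by (rule eq_matI) (auto simp: gram simp del: index_mult_mat(1), auto simp: A_def)
  moreover have "(t\<^sup>2 + 1) * real k > 0"
    using k by (intro mult_pos_pos add_nonneg_pos) auto
  moreover have "A \<in> carrier_mat q q"
    by (simp add: A_def)
  ultimately have "scaled_orthogonal q A"
    unfolding scaled_orthogonal_def by blast
  then have "OMZD q A"
    using t(1) by (simp add: OMZD_def A_def arc_weight_same arc_weight_nonzero hV h_neq)
  then show ?thesis
    by blast
qed

end
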